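(* Let $\mathfrak X$ be a category with arbitrary coproducts. Every covariant functor $\gamma:\mathbf{Set}\to\mathfrak X$ sending coproducts to coproducts is naturally equivalent to the covariant functor $\mathcal F_K:\mathbf{Set}\to\mathfrak X$ for an appropriate object $K$ of $\mathfrak X$.
   Context: $\mathbf{Set}$ is the category of sets and maps. Since $\mathfrak X$ has arbitrary coproducts it has an initial object (the empty coproduct), and a fixed one is denoted $0$. For an object $K$ of $\mathfrak X$ and a non-empty set $X$, $K^{(X)}$ denotes the coproduct of $|X|$-many copies of $K$, and $\iota_x:K\to K^{(X)}$ is the canonical morphism relative to $x\in X$. For non-empty sets $X,Y$ and a map $\lambda:X\to Y$, the forward generalized shift $\tau_\lambda:K^{(X)}\to K^{(Y)}$ is the unique morphism in $\mathfrak X$ with $\tau_\lambda\circ\iota_x=\iota_{\lambda(x)}$ for every $x\in X$. The covariant functor $\mathcal F_K:\mathbf{Set}\to\mathfrak X$ is defined by $\mathcal F_K(X)=K^{(X)}$ for $X\ne\emptyset$, $\mathcal F_K(\emptyset)=0$, $\mathcal F_K(\lambda)=\tau_\lambda$ for $\lambda:X\to Y$ with $X,Y$ non-empty, and $\mathcal F_K(\lambda)$ equal to the unique morphism from $0$ when $X=\emptyset$. A covariant functor $\gamma$ sends coproducts to coproducts if for every family of sets $(X_i)_{i\in I}$ (including the empty family) with coproduct $X$ and canonical maps $j_i:X_i\to X$, the object $\gamma(X)$ with the morphisms $\gamma(j_i)$ is a coproduct of the family $(\gamma(X_i))_{i\in I}$ in $\mathfrak X$. *)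

theory Defs
  imports Main "HOL-Library.FuncSet"
begin

section \<open>Categories, functors, natural equivalence\<close>

record ('o, 'm) cat =
  Obj :: "'o set"
  Arr :: "'m set"
  Dom :: "'m \<Rightarrow> 'o"
  Cod :: "'m \<Rightarrow> 'o"
  Id :: "'o \<Rightarrow> 'm"
  Comp :: "'m \<Rightarrow> 'm \<Rightarrow> 'm" (infixr "\<cdot>\<index>" 70)

definition Hom :: "('o, 'm) cat \<Rightarrow> 'o \<Rightarrow> 'o \<Rightarrow> 'm set" where
  "Hom C a b = {f \<in> Arr C. Dom C f = a \<and> Cod C f = b}"

locale category =
  fixes C :: "('o, 'm) cat" (structure)
  assumes Dom_Obj: "f \<in> Arr C \<Longrightarrow> Dom C f \<in> Obj C"
    and Cod_Obj: "f \<in> Arr C \<Longrightarrow> Cod C f \<in> Obj C"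
    and Id_Hom: "a \<in> Obj C \<Longrightarrow> Id C a \<in> Hom C a a"
    and Comp_Hom: "f \<in> Hom C a b \<Longrightarrow> g \<in> Hom C b c \<Longrightarrow> g \<cdot> f \<in> Hom C a c"
    and Id_left: "f \<in> Hom C a b \<Longrightarrow> Id C b \<cdot> f = f"
    and Id_right: "f \<in> Hom C a b \<Longrightarrow> f \<cdot> Id C a = f"
    and Comp_assoc: "f \<in> Hom C a b \<Longrightarrow> g \<in> Hom C b c \<Longrightarrow> h \<in> Hom C c d \<Longrightarrow>
      (h \<cdot> g) \<cdot> f = h \<cdot> (g \<cdot> f)"

definition iso :: "('o, 'm) cat \<Rightarrow> 'o \<Rightarrow> 'o \<Rightarrow> 'm \<Rightarrow> bool" where
  "iso C a b f \<longleftrightarrow> f \<in> Hom C a b \<and>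
     (\<exists>g \<in> Hom C b a. g \<cdot>\<^bsub>C\<^esub> f = Id C a \<and> f \<cdot>\<^bsub>C\<^esub> g = Id C b)"

record ('o, 'm, 'p, 'n) func =
  on_obj :: "'o \<Rightarrow> 'p"
  on_arr :: "'m \<Rightarrow> 'n"

locale covariant_functor =
  source: category C + target: category D
  for C :: "('o, 'm) cat" and D :: "('p, 'n) cat" +
  fixes F :: "('o, 'm, 'p, 'n) func"
  assumes on_obj_Obj: "a \<in> Obj C \<Longrightarrow> on_obj F a \<in> Obj D"
    and on_arr_Hom: "f \<in> Hom C a b \<Longrightarrow> on_arr F f \<in> Hom D (on_obj F a) (on_obj F b)"
    and on_arr_Id: "a \<in> Obj C \<Longrightarrow> on_arr F (Id C a) = Id D (on_obj F a)"
    and on_arr_Comp: "f \<in> Hom C a b \<Longrightarrow> g \<in> Hom C b c \<Longrightarrow>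
      on_arr F (g \<cdot>\<^bsub>C\<^esub> f) = on_arr F g \<cdot>\<^bsub>D\<^esub> on_arr F f"

locale natural_transformation =
  F: covariant_functor C D F + G: covariant_functor C D G
  for C :: "('o, 'm) cat" and D :: "('p, 'n) cat" and F G +
  fixes \<eta> :: "'o \<Rightarrow> 'n"
  assumes component_Hom: "a \<in> Obj C \<Longrightarrow> \<eta> a \<in> Hom D (on_obj F a) (on_obj G a)"
    and naturality: "f \<in> Hom C a b \<Longrightarrow> \<eta> b \<cdot>\<^bsub>D\<^esub> on_arr F f = on_arr G f \<cdot>\<^bsub>D\<^esub> \<eta> a"

definition naturally_equivalent ::
    "('o, 'm) cat \<Rightarrow> ('p, 'n) cat \<Rightarrow> ('o, 'm, 'p, 'n) func \<Rightarrow> ('o, 'm, 'p, 'n) func \<Rightarrow> bool" where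
  "naturally_equivalent C D F G \<longleftrightarrow>
     (\<exists>\<eta>. natural_transformation C D F G \<eta> \<and>
          (\<forall>a \<in> Obj C. iso D (on_obj F a) (on_obj G a) (\<eta> a)))"


section \<open>Coproducts\<close>

definition is_coproduct ::
    "('o, 'm) cat \<Rightarrow> 'i set \<Rightarrow> ('i \<Rightarrow> 'o) \<Rightarrow> 'o \<Rightarrow> ('i \<Rightarrow> 'm) \<Rightarrow> bool" where
  "is_coproduct C I A P j \<longleftrightarrow>
     P \<in> Obj C \<and> (\<forall>i \<in> I. j i \<in> Hom C (A i) P) \<and>
     (\<forall>T \<in> Obj C. \<forall>f. (\<forall>i \<in> I. f i \<in> Hom C (A i) T) \<longrightarrow>
        (\<exists>!h. h \<in> Hom C P T \<and> (\<forall>i \<in> I. h \<cdot>\<^bsub>C\<^esub> j i = f i)))"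

definition is_initial :: "('o, 'm) cat \<Rightarrow> 'o \<Rightarrow> bool" where
  "is_initial C z \<longleftrightarrow> z \<in> Obj C \<and> (\<forall>T \<in> Obj C. \<exists>!h. h \<in> Hom C z T)"


section \<open>The category of sets\<close>

text \<open>
  HOL has no type of all sets, so the sets of the ambient set theory are the members of a
  collection \<open>U\<close> of ``small'' subsets of a type \<open>'u\<close>; all families are indexed
  by members of \<open>U\<close>. The type and \<open>U\<close> are arbitrary subject to the closure conditions
  below. These hold in particular when \<open>'u\<close> is a model of ZF with replacement for all HOL functions and
  \<open>U\<close> consists of the extensions of its elements, and when \<open>'u\<close> is a Grothendieck universe
  with an infinite member and \<open>U\<close> consists of its members. They also hold when
  \<open>'u\<close> is any infinite type and \<open>U\<close> contains all its subsets, so the conditions are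
  satisfiable in plain HOL; this is why closure under power sets, which is not needed here, is not
  required. Closure under images follows from \<open>singleton\<close> and \<open>Union\<close>, and
  closure under disjoint unions follows from that and an injection of \<open>'u \<times> 'u\<close> into
  \<open>'u\<close>.
\<close>

locale set_universe =
  fixes U :: "'u set set"
  assumes subset: "A \<in> U \<Longrightarrow> B \<subseteq> A \<Longrightarrow> B \<in> U"
    and singleton: "{x} \<in> U"
    and Union: "I \<in> U \<Longrightarrow> (\<And>i. i \<in> I \<Longrightarrow> X i \<in> U) \<Longrightarrow> (\<Union>i\<in>I. X i) \<in> U"
    and infinite: "\<exists>A \<in> U. infinite A"

lemma set_universe_UNIV:
  assumes "infinite (UNIV :: 'u set)"
  shows "set_universe (UNIV :: 'u set set)"
  using assms by unfold_locales auto

datatype 'u set_map = Set_Map (src: "'u set") (app: "'u \<Rightarrow> 'u") (tgt: "'u set")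

definition Set_cat :: "'u set set \<Rightarrow> ('u set, 'u set_map) cat" where
  "Set_cat U =
     \<lparr> Obj = U,
       Arr = {Set_Map X f Y | X f Y. X \<in> U \<and> Y \<in> U \<and> f \<in> X \<rightarrow>\<^sub>E Y},
       Dom = src,
       Cod = tgt,
       Id = (\<lambda>X. Set_Map X (\<lambda>x\<in>X. x) X),
       Comp = (\<lambda>g f. Set_Map (src f) (compose (src f) (app g) (app f)) (tgt g)) \<rparr>"

lemma category_Set_cat: "category (Set_cat U)"
proof -
  have Hom: "Hom (Set_cat U) X Y = {Set_Map X f Y | f. X \<in> U \<and> Y \<in> U \<and> f \<in> X \<rightarrow>\<^sub>E Y}" for X Y
    by (auto simp: Set_cat_def Hom_def)
  have comp: "Set_Map Y g Z \<cdot>\<^bsub>Set_cat U\<^esub> Set_Map X f Y = Set_Map X (compose X g f) Z" for X Y Z f g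
    by (simp add: Set_cat_def)
  have ident: "Id (Set_cat U) X = Set_Map X (\<lambda>x\<in>X. x) X" for X
    by (simp add: Set_cat_def)
  show ?thesis
  proof
    show "Dom (Set_cat U) f \<in> Obj (Set_cat U)" if "f \<in> Arr (Set_cat U)" for f
      using that by (auto simp: Set_cat_def)
    show "Cod (Set_cat U) f \<in> Obj (Set_cat U)" if "f \<in> Arr (Set_cat U)" for f
      using that by (auto simp: Set_cat_def)
    show "Id (Set_cat U) X \<in> Hom (Set_cat U) X X" if "X \<in> Obj (Set_cat U)" for X
      using that by (auto simp: Hom ident) (simp add: Set_cat_def)
    show "g \<cdot>\<^bsub>Set_cat U\<^esub> f \<in> Hom (Set_cat U) X Z"
      if "f \<in> Hom (Set_cat U) X Y" "g \<in> Hom (Set_cat U) Y Z" for f g X Y Z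
      using that by (auto simp: Hom comp) (auto simp: compose_def)
    show "Id (Set_cat U) Y \<cdot>\<^bsub>Set_cat U\<^esub> f = f" if "f \<in> Hom (Set_cat U) X Y" for f X Y
      using that by (auto simp: Hom comp ident PiE_def Id_compose)
    show "f \<cdot>\<^bsub>Set_cat U\<^esub> Id (Set_cat U) X = f" if "f \<in> Hom (Set_cat U) X Y" for f X Y
      using that by (auto simp: Hom comp ident PiE_def compose_Id)
    show "(h \<cdot>\<^bsub>Set_cat U\<^esub> g) \<cdot>\<^bsub>Set_cat U\<^esub> f = h \<cdot>\<^bsub>Set_cat U\<^esub> (g \<cdot>\<^bsub>Set_cat U\<^esub> f)"
      if "f \<in> Hom (Set_cat U) W X" "g \<in> Hom (Set_cat U) X Y" "h \<in> Hom (Set_cat U) Y Z"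
      for f g h W X Y Z
      using that by (auto simp: Hom comp PiE_def compose_assoc)
  qed
qed

definition has_coproducts :: "'u set set \<Rightarrow> ('o, 'm) cat \<Rightarrow> bool" where
  "has_coproducts U C \<longleftrightarrow>
     (\<forall>I \<in> U. \<forall>A. (\<forall>i \<in> I. A i \<in> Obj C) \<longrightarrow> (\<exists>P j. is_coproduct C I A P j))"

definition sends_coproducts_to_coproducts ::
    "'u set set \<Rightarrow> ('o, 'm) cat \<Rightarrow> ('u set, 'u set_map, 'o, 'm) func \<Rightarrow> bool" where
  "sends_coproducts_to_coproducts U C \<gamma> \<longleftrightarrow>
     (\<forall>I \<in> U. \<forall>X P j. is_coproduct (Set_cat U) I X P j \<longrightarrow>
        is_coproduct C I (\<lambda>i. on_obj \<gamma> (X i)) (on_obj \<gamma> P) (\<lambda>i. on_arr \<gamma> (j i)))"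


section \<open>The functor of copowers of an object\<close>

text \<open>
  The initial object \<open>z\<close>, the copowers \<open>pw K X\<close> and their canonical morphisms
  \<open>inc K X x\<close> are choices, unique only up to isomorphism, on which the functor depends.
\<close>

definition copower_choice ::
    "'u set set \<Rightarrow> ('o, 'm) cat \<Rightarrow> 'o \<Rightarrow> ('o \<Rightarrow> 'u set \<Rightarrow> 'o) \<Rightarrow> ('o \<Rightarrow> 'u set \<Rightarrow> 'u \<Rightarrow> 'm) \<Rightarrow> bool" where
  "copower_choice U C z pw inc \<longleftrightarrow>
     is_initial C z \<and>
     (\<forall>K \<in> Obj C. \<forall>X \<in> U. X \<noteq> {} \<longrightarrow> is_coproduct C X (\<lambda>_. K) (pw K X) (inc K X))"

lemma copower_choice_exists:
  fixes U :: "'a set set" and C :: "('b, 'c) cat"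
  assumes "set_universe U" "has_coproducts U C"
  shows "\<exists>z pw inc. copower_choice U C z pw inc"
proof -
  interpret set_universe U by fact
  have "{} \<in> U" by (rule subset[OF singleton empty_subsetI])
  then have "\<exists>z j. is_coproduct C {} (\<lambda>_. undefined) z (j :: 'a \<Rightarrow> 'c)"
    using assms(2) unfolding has_coproducts_def by simp
  then obtain z and j :: "'a \<Rightarrow> 'c" where "is_coproduct C {} (\<lambda>_. undefined) z j"
    by (elim exE)
  then have z: "is_initial C z" by (simp add: is_coproduct_def is_initial_def)
  define c where "c = (\<lambda>K X. SOME p. is_coproduct C X (\<lambda>_. K) (fst p) (snd p :: 'a \<Rightarrow> 'c))"
  have "is_coproduct C X (\<lambda>_. K) (fst (c K X)) (snd (c K X))" if "K \<in> Obj C" "X \<in> U" for K X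
  proof -
    have "\<exists>p. is_coproduct C X (\<lambda>_. K) (fst p) (snd p :: 'a \<Rightarrow> 'c)"
      using assms(2) that unfolding has_coproducts_def by simp
    then show ?thesis unfolding c_def by (rule someI_ex)
  qed
  with z have "copower_choice U C z (\<lambda>K X. fst (c K X)) (\<lambda>K X. snd (c K X))"
    unfolding copower_choice_def by simp
  then show ?thesis by (intro exI)
qed

definition forward_shift ::
    "('o, 'm) cat \<Rightarrow> ('o \<Rightarrow> 'u set \<Rightarrow> 'o) \<Rightarrow> ('o \<Rightarrow> 'u set \<Rightarrow> 'u \<Rightarrow> 'm) \<Rightarrow> 'o \<Rightarrow> 'u set_map \<Rightarrow> 'm" where
  "forward_shift C pw inc K l =
     (THE t. t \<in> Hom C (pw K (src l)) (pw K (tgt l)) \<and>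
        (\<forall>x \<in> src l. t \<cdot>\<^bsub>C\<^esub> inc K (src l) x = inc K (tgt l) (app l x)))"

definition copower_obj :: "'o \<Rightarrow> ('o \<Rightarrow> 'u set \<Rightarrow> 'o) \<Rightarrow> 'o \<Rightarrow> 'u set \<Rightarrow> 'o" where
  "copower_obj z pw K X = (if X = {} then z else pw K X)"

definition copower_functor ::
    "('o, 'm) cat \<Rightarrow> 'o \<Rightarrow> ('o \<Rightarrow> 'u set \<Rightarrow> 'o) \<Rightarrow> ('o \<Rightarrow> 'u set \<Rightarrow> 'u \<Rightarrow> 'm) \<Rightarrow> 'o \<Rightarrow>
     ('u set, 'u set_map, 'o, 'm) func" where
  "copower_functor C z pw inc K =
     \<lparr> on_obj = copower_obj z pw K,
       on_arr = (\<lambda>l. if src l = {} then THE h. h \<in> Hom C z (copower_obj z pw K (tgt l))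
                     else forward_shift C pw inc K l) \<rparr>"

end

theory Submission
  imports Defs
begin

text \<open>
  Every set \<open>X\<close> is the coproduct of \<open>X\<close>-many copies of a singleton \<open>P\<close>, so a functor \<open>\<gamma>\<close> that
  preserves coproducts makes \<open>\<gamma> X\<close> a copower of \<open>K = \<gamma> P\<close>, where a map \<open>l\<close> acts by relabelling
  the canonical morphisms: \<open>\<gamma> l \<cdot> \<gamma> j\<^sub>x = \<gamma> j\<^bsub>l x\<^esub>\<close>. The chosen copowers of \<open>K\<close> behave in the same way, and the
  comparison morphisms between two copowers of \<open>K\<close> are isomorphisms, natural by uniqueness.
\<close>

section \<open>Coproducts in an arbitrary category\<close>

lemma coproduct_Obj: "is_coproduct C I A P j \<Longrightarrow> P \<in> Obj C"
  by (simp add: is_coproduct_def)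

lemma coproduct_inclusion_Hom: "is_coproduct C I A P j \<Longrightarrow> i \<in> I \<Longrightarrow> j i \<in> Hom C (A i) P"
  by (simp add: is_coproduct_def)

lemma coproduct_ex1:
  assumes "is_coproduct C I A P j" "T \<in> Obj C" "\<And>i. i \<in> I \<Longrightarrow> f i \<in> Hom C (A i) T"
  shows "\<exists>!h. h \<in> Hom C P T \<and> (\<forall>i \<in> I. h \<cdot>\<^bsub>C\<^esub> j i = f i)"
  using assms unfolding is_coproduct_def by blast

context category
begin

lemma Hom_Obj:
  assumes "f \<in> Hom C a b"
  shows "a \<in> Obj C" "b \<in> Obj C"
  using assms Dom_Obj Cod_Obj by (auto simp: Hom_def)

text \<open>Both morphisms mediate for the family \<open>g \<cdot> j i\<close>, and the universal
  property admits only one such morphism. Every later equality of morphisms out of a copower is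
  reduced to the inclusions in this way.\<close>

lemma coproduct_ext:
  assumes P: "is_coproduct C I A P j"
    and f: "f \<in> Hom C P T" and g: "g \<in> Hom C P T"
    and eq: "\<And>i. i \<in> I \<Longrightarrow> f \<cdot> j i = g \<cdot> j i"
  shows "f = g"
proof -
  have "\<exists>!h. h \<in> Hom C P T \<and> (\<forall>i \<in> I. h \<cdot> j i = g \<cdot> j i)"
    using P Hom_Obj(2)[OF g]
    by (rule coproduct_ex1) (rule Comp_Hom[OF coproduct_inclusion_Hom[OF P] g])
  with f g eq show ?thesis by blast
qed

text \<open>The composite \<open>g \<cdot> h\<close> fixes every inclusion \<open>j i\<close>, as
  the identity does. Stated for one side only, so that swapping \<open>P\<close> and
  \<open>Q\<close> gives the other composite.\<close>

lemma coproduct_comparison_inverse: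
  assumes P: "is_coproduct C I A P j"
    and h: "h \<in> Hom C P Q" "\<And>i. i \<in> I \<Longrightarrow> h \<cdot> j i = k i"
    and g: "g \<in> Hom C Q P" "\<And>i. i \<in> I \<Longrightarrow> g \<cdot> k i = j i"
  shows "g \<cdot> h = Id C P"
proof (rule coproduct_ext[OF P])
  show "g \<cdot> h \<in> Hom C P P" using h(1) g(1) by (rule Comp_Hom)
  show "Id C P \<in> Hom C P P" using coproduct_Obj[OF P] by (rule Id_Hom)
  fix i assume "i \<in> I"
  then show "(g \<cdot> h) \<cdot> j i = Id C P \<cdot> j i"
    using Comp_assoc[OF coproduct_inclusion_Hom[OF P] h(1) g(1)] h(2) g(2)
      Id_left[OF coproduct_inclusion_Hom[OF P]] by simp
qed

lemma iso_coproduct_comparison: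
  assumes P: "is_coproduct C I A P j" and Q: "is_coproduct C I A Q k"
    and h: "h \<in> Hom C P Q" "\<And>i. i \<in> I \<Longrightarrow> h \<cdot> j i = k i"
  shows "iso C P Q h"
proof -
  obtain g where g: "g \<in> Hom C Q P" "\<And>i. i \<in> I \<Longrightarrow> g \<cdot> k i = j i"
    using coproduct_ex1[OF Q coproduct_Obj[OF P] coproduct_inclusion_Hom[OF P]] by blast
  have "g \<cdot> h = Id C P" "h \<cdot> g = Id C Q"
    using coproduct_comparison_inverse[OF P h g] coproduct_comparison_inverse[OF Q g h] by simp_all
  then show ?thesis using h(1) g(1) unfolding iso_def by blast
qed

end

section \<open>Arrows of the category of sets\<close>

lemma Obj_Set_cat [simp]: "Obj (Set_cat U) = U"
  by (simp add: Set_cat_def)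

lemma Id_Set_cat: "Id (Set_cat U) X = Set_Map X (\<lambda>x\<in>X. x) X"
  by (simp add: Set_cat_def)

lemma Comp_Set_cat: "g \<cdot>\<^bsub>Set_cat U\<^esub> f = Set_Map (src f) (compose (src f) (app g) (app f)) (tgt g)"
  by (simp add: Set_cat_def)

lemma Hom_Set_cat_iff:
  "f \<in> Hom (Set_cat U) X Y \<longleftrightarrow>
     X \<in> U \<and> Y \<in> U \<and> src f = X \<and> tgt f = Y \<and> app f \<in> X \<rightarrow>\<^sub>E Y"
  by (cases f) (auto simp: Set_cat_def Hom_def)

lemma Hom_Set_cat_app: "f \<in> Hom (Set_cat U) X Y \<Longrightarrow> x \<in> X \<Longrightarrow> app f x \<in> Y"
  by (auto simp: Hom_Set_cat_iff)

lemma Hom_Set_cat_eqI: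
  assumes "f \<in> Hom (Set_cat U) X Y" "g \<in> Hom (Set_cat U) X Y"
    and "\<And>x. x \<in> X \<Longrightarrow> app f x = app g x"
  shows "f = g"
  using assms by (intro set_map.expand) (auto simp: Hom_Set_cat_iff intro: PiE_ext)

section \<open>A set as a copower of a singleton\<close>

text \<open>An element viewed as a map from the singleton \<open>{u}\<close>. The restricted
  abstraction makes the map extensional, as arrows of \<open>Set_cat U\<close> have to be.\<close>

definition point :: "'u \<Rightarrow> 'u set \<Rightarrow> 'u \<Rightarrow> 'u set_map" where
  "point u X x = Set_Map {u} (\<lambda>_\<in>{u}. x) X"

lemma point_Hom:
  "{u} \<in> U \<Longrightarrow> X \<in> U \<Longrightarrow> x \<in> X \<Longrightarrow> point u X x \<in> Hom (Set_cat U) {u} X"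
  by (auto simp: Hom_Set_cat_iff point_def)

lemma Comp_point: "f \<in> Hom (Set_cat U) X Y \<Longrightarrow> f \<cdot>\<^bsub>Set_cat U\<^esub> point u X x = point u Y (app f x)"
  by (auto simp: Hom_Set_cat_iff point_def Comp_Set_cat compose_def)

lemma point_app: "f \<in> Hom (Set_cat U) {u} Y \<Longrightarrow> point u Y (app f u) = f"
  by (cases f) (auto simp: Hom_Set_cat_iff point_def PiE_def extensional_def fun_eq_iff)

lemma point_eq_iff: "point u X x = point u X y \<longleftrightarrow> x = y"
  by (auto simp: point_def dest: fun_cong[where x = u])

text \<open>A map out of \<open>X\<close> is determined by its values at the elements of
  \<open>X\<close>, that is, by its composites with the points. For empty \<open>X\<close> this says
  that the empty set is initial.\<close>

lemma is_coproduct_points: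
  assumes u: "{u} \<in> U" and X: "X \<in> U"
  shows "is_coproduct (Set_cat U) X (\<lambda>_. {u}) X (point u X)"
  unfolding is_coproduct_def
proof (intro conjI ballI allI impI)
  show "X \<in> Obj (Set_cat U)" using X by simp
  show "point u X x \<in> Hom (Set_cat U) {u} X" if "x \<in> X" for x
    using u X that by (rule point_Hom)
  fix T and f :: "'a \<Rightarrow> 'a set_map"
  assume T: "T \<in> Obj (Set_cat U)" and f: "\<forall>x\<in>X. f x \<in> Hom (Set_cat U) {u} T"
  \<comment> \<open>The value at \<open>x\<close> is forced, because an arrow out of
    \<open>{u}\<close> is known from its value at \<open>u\<close>.\<close>
  define h where "h = Set_Map X (\<lambda>x\<in>X. app (f x) u) T"
  have h: "h \<in> Hom (Set_cat U) X T"
    using X T f by (auto simp: h_def Hom_Set_cat_iff)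
  show "\<exists>!h. h \<in> Hom (Set_cat U) X T \<and> (\<forall>x\<in>X. h \<cdot>\<^bsub>Set_cat U\<^esub> point u X x = f x)"
  proof (intro ex1I conjI ballI)
    show "h \<in> Hom (Set_cat U) X T" by (rule h)
    fix x assume "x \<in> X"
    then show "h \<cdot>\<^bsub>Set_cat U\<^esub> point u X x = f x"
      using f by (simp add: Comp_point[OF h]) (simp add: h_def point_app[where U = U])
  next
    fix g assume g: "g \<in> Hom (Set_cat U) X T \<and> (\<forall>x\<in>X. g \<cdot>\<^bsub>Set_cat U\<^esub> point u X x = f x)"
    show "g = h"
    proof (rule Hom_Set_cat_eqI[OF _ h])
      show "g \<in> Hom (Set_cat U) X T" using g by blast
      fix x assume x: "x \<in> X"
      then have "point u T (app g x) = point u T (app (f x) u)"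
        using f g by (metis Comp_point point_app)
      then show "app g x = app h x" using x by (simp add: point_eq_iff h_def)
    qed
  qed
qed

section \<open>Comparison of two functors of copowers\<close>

text \<open>The comparison morphisms carrying \<open>i X x\<close> to \<open>k X x\<close> are
  isomorphisms, as both objects are coproducts of the same family. They are natural because both
  functors act on the inclusions by relabelling along \<open>l\<close>.\<close>

lemma naturally_equivalent_copowers:
  assumes F: "covariant_functor (Set_cat U) C F" and G: "covariant_functor (Set_cat U) C G"
    and coF: "\<And>X. X \<in> U \<Longrightarrow> is_coproduct C X (\<lambda>_. K) (on_obj F X) (i X)"
    and coG: "\<And>X. X \<in> U \<Longrightarrow> is_coproduct C X (\<lambda>_. K) (on_obj G X) (k X)"
    and actF: "\<And>X Y l x. l \<in> Hom (Set_cat U) X Y \<Longrightarrow> x \<in> X \<Longrightarrow>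
      on_arr F l \<cdot>\<^bsub>C\<^esub> i X x = i Y (app l x)"
    and actG: "\<And>X Y l x. l \<in> Hom (Set_cat U) X Y \<Longrightarrow> x \<in> X \<Longrightarrow>
      on_arr G l \<cdot>\<^bsub>C\<^esub> k X x = k Y (app l x)"
  shows "naturally_equivalent (Set_cat U) C F G"
proof -
  interpret F: covariant_functor "Set_cat U" C F by (rule F)
  interpret G: covariant_functor "Set_cat U" C G by (rule G)
  have "\<exists>h. h \<in> Hom C (on_obj F X) (on_obj G X) \<and> (\<forall>x\<in>X. h \<cdot>\<^bsub>C\<^esub> i X x = k X x)" if "X \<in> U" for X
    using coproduct_ex1[OF coF[OF that] coproduct_Obj[OF coG[OF that]],
        where f = "k X", OF coproduct_inclusion_Hom[OF coG[OF that]]] by blast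
  then obtain \<eta> where \<eta>: "\<And>X. X \<in> U \<Longrightarrow> \<eta> X \<in> Hom C (on_obj F X) (on_obj G X)"
    and \<eta>_i: "\<And>X x. X \<in> U \<Longrightarrow> x \<in> X \<Longrightarrow> \<eta> X \<cdot>\<^bsub>C\<^esub> i X x = k X x"
    by metis
  have "natural_transformation (Set_cat U) C F G \<eta>"
  proof
    show "\<eta> X \<in> Hom C (on_obj F X) (on_obj G X)" if "X \<in> Obj (Set_cat U)" for X
      using that \<eta> by simp
    fix l X Y assume l: "l \<in> Hom (Set_cat U) X Y"
    then have X: "X \<in> U" and Y: "Y \<in> U" by (simp_all add: Hom_Set_cat_iff)
    note Fl = F.on_arr_Hom[OF l] and Gl = G.on_arr_Hom[OF l]
    show "\<eta> Y \<cdot>\<^bsub>C\<^esub> on_arr F l = on_arr G l \<cdot>\<^bsub>C\<^esub> \<eta> X"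
    proof (rule F.target.coproduct_ext[OF coF[OF X]])
      show "\<eta> Y \<cdot>\<^bsub>C\<^esub> on_arr F l \<in> Hom C (on_obj F X) (on_obj G Y)"
        using Fl \<eta>[OF Y] by (rule F.target.Comp_Hom)
      show "on_arr G l \<cdot>\<^bsub>C\<^esub> \<eta> X \<in> Hom C (on_obj F X) (on_obj G Y)"
        using \<eta>[OF X] Gl by (rule F.target.Comp_Hom)
      fix x assume x: "x \<in> X"
      note ix = coproduct_inclusion_Hom[OF coF[OF X] x]
      \<comment> \<open>Either way round the square, the inclusion at \<open>x\<close> ends up as
        the inclusion at \<open>app l x\<close> in the copower \<open>on_obj G Y\<close>.\<close>
      have "(\<eta> Y \<cdot>\<^bsub>C\<^esub> on_arr F l) \<cdot>\<^bsub>C\<^esub> i X x = k Y (app l x)"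
        using F.target.Comp_assoc[OF ix Fl \<eta>[OF Y]] actF[OF l x]
          \<eta>_i[OF Y Hom_Set_cat_app[OF l x]] by simp
      also have "\<dots> = (on_arr G l \<cdot>\<^bsub>C\<^esub> \<eta> X) \<cdot>\<^bsub>C\<^esub> i X x"
        using F.target.Comp_assoc[OF ix \<eta>[OF X] Gl] actG[OF l x] \<eta>_i[OF X x] by simp
      finally show "(\<eta> Y \<cdot>\<^bsub>C\<^esub> on_arr F l) \<cdot>\<^bsub>C\<^esub> i X x = (on_arr G l \<cdot>\<^bsub>C\<^esub> \<eta> X) \<cdot>\<^bsub>C\<^esub> i X x" .
    qed
  qed
  moreover have "iso C (on_obj F X) (on_obj G X) (\<eta> X)" if "X \<in> Obj (Set_cat U)" for X
    using that F.target.iso_coproduct_comparison[OF coF coG \<eta> \<eta>_i] by simp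
  ultimately show ?thesis unfolding naturally_equivalent_def by blast
qed

section \<open>The functor of chosen copowers\<close>

text \<open>An initial object is a coproduct of the empty family, whatever \<open>inc K {}\<close>
  may be. Hence the empty set needs no separate treatment from here on.\<close>

lemma is_coproduct_copower_obj:
  assumes "copower_choice U C z pw inc" "K \<in> Obj C" "X \<in> U"
  shows "is_coproduct C X (\<lambda>_. K) (copower_obj z pw K X) (inc K X)"
  using assms
  by (auto simp: copower_choice_def copower_obj_def is_initial_def is_coproduct_def[of C "{}"])

lemma copower_functor_on_obj: "on_obj (copower_functor C z pw inc K) = copower_obj z pw K"
  by (simp add: copower_functor_def)

text \<open>Merges the two branches of the definition: for empty \<open>X\<close> the condition on
  inclusions is vacuous, and for non-empty \<open>X\<close> the set \<open>Y\<close> is non-empty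
  too, so that both objects are chosen copowers.\<close>

lemma copower_functor_on_arr:
  assumes "l \<in> Hom (Set_cat U) X Y"
  shows "on_arr (copower_functor C z pw inc K) l =
    (THE t. t \<in> Hom C (copower_obj z pw K X) (copower_obj z pw K Y) \<and>
       (\<forall>x \<in> X. t \<cdot>\<^bsub>C\<^esub> inc K X x = inc K Y (app l x)))"
proof (cases "X = {}")
  case True
  with assms show ?thesis by (simp add: copower_functor_def copower_obj_def Hom_Set_cat_iff)
next
  case False
  with assms have "Y \<noteq> {}" by (auto simp: Hom_Set_cat_iff)
  with False assms show ?thesis
    by (simp add: copower_functor_def copower_obj_def forward_shift_def Hom_Set_cat_iff)
qed

lemma copower_functor_on_arr_spec:
  assumes choice: "copower_choice U C z pw inc" and K: "K \<in> Obj C"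
    and l: "l \<in> Hom (Set_cat U) X Y"
  shows "on_arr (copower_functor C z pw inc K) l \<in>
      Hom C (copower_obj z pw K X) (copower_obj z pw K Y)"
    and "x \<in> X \<Longrightarrow> on_arr (copower_functor C z pw inc K) l \<cdot>\<^bsub>C\<^esub> inc K X x = inc K Y (app l x)"
proof -
  have X: "X \<in> U" and Y: "Y \<in> U" using l by (simp_all add: Hom_Set_cat_iff)
  note co = is_coproduct_copower_obj[OF choice K]
  have "\<exists>!t. t \<in> Hom C (copower_obj z pw K X) (copower_obj z pw K Y) \<and>
       (\<forall>x \<in> X. t \<cdot>\<^bsub>C\<^esub> inc K X x = inc K Y (app l x))"
    using co[OF X] coproduct_Obj[OF co[OF Y]]
    by (rule coproduct_ex1) (rule coproduct_inclusion_Hom[OF co[OF Y] Hom_Set_cat_app[OF l]])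
  \<comment> \<open>Existence and uniqueness make the definite description denote the mediating
    morphism.\<close>
  from theI'[OF this, folded copower_functor_on_arr[OF l]]
  show "on_arr (copower_functor C z pw inc K) l \<in>
      Hom C (copower_obj z pw K X) (copower_obj z pw K Y)"
    and "x \<in> X \<Longrightarrow> on_arr (copower_functor C z pw inc K) l \<cdot>\<^bsub>C\<^esub> inc K X x = inc K Y (app l x)"
    by blast+
qed

text \<open>Each functor law is checked on the inclusions, where it becomes the corresponding law
  for the maps of labels.\<close>

lemma covariant_functor_copower_functor:
  assumes cat: "category C" and choice: "copower_choice U C z pw inc" and K: "K \<in> Obj C"
  shows "covariant_functor (Set_cat U) C (copower_functor C z pw inc K)" (is "covariant_functor _ _ ?F")
proof -
  interpret C: category C by (rule cat)
  interpret S: category "Set_cat U" by (rule category_Set_cat)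
  note co = is_coproduct_copower_obj[OF choice K]
  note arr = copower_functor_on_arr_spec(1)[OF choice K, folded copower_functor_on_obj[of C z pw inc K]]
    and act = copower_functor_on_arr_spec(2)[OF choice K]
  show ?thesis
  proof
    show "on_obj ?F X \<in> Obj C" if "X \<in> Obj (Set_cat U)" for X
      using that coproduct_Obj[OF co] by (simp add: copower_functor_on_obj)
    show "on_arr ?F l \<in> Hom C (on_obj ?F X) (on_obj ?F Y)" if "l \<in> Hom (Set_cat U) X Y" for l X Y
      using that by (rule arr)
    show "on_arr ?F (Id (Set_cat U) X) = Id C (on_obj ?F X)" if X: "X \<in> Obj (Set_cat U)" for X
    proof -
      have coX: "is_coproduct C X (\<lambda>_. K) (on_obj ?F X) (inc K X)"
        using co X by (simp add: copower_functor_on_obj)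
      show ?thesis
      proof (rule C.coproduct_ext[OF coX arr[OF S.Id_Hom[OF X]] C.Id_Hom[OF coproduct_Obj[OF coX]]])
        fix x assume x: "x \<in> X"
        then show "on_arr ?F (Id (Set_cat U) X) \<cdot>\<^bsub>C\<^esub> inc K X x = Id C (on_obj ?F X) \<cdot>\<^bsub>C\<^esub> inc K X x"
          using act[OF S.Id_Hom[OF X] x] C.Id_left[OF coproduct_inclusion_Hom[OF coX x]]
          by (simp add: Id_Set_cat)
      qed
    qed
    show "on_arr ?F (g \<cdot>\<^bsub>Set_cat U\<^esub> f) = on_arr ?F g \<cdot>\<^bsub>C\<^esub> on_arr ?F f"
      if f: "f \<in> Hom (Set_cat U) X Y" and g: "g \<in> Hom (Set_cat U) Y Z" for f g X Y Z
    proof -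
      have coX: "is_coproduct C X (\<lambda>_. K) (on_obj ?F X) (inc K X)"
        using co f by (simp add: copower_functor_on_obj Hom_Set_cat_iff)
      have gf: "g \<cdot>\<^bsub>Set_cat U\<^esub> f \<in> Hom (Set_cat U) X Z" using f g by (rule S.Comp_Hom)
      show ?thesis
      proof (rule C.coproduct_ext[OF coX arr[OF gf] C.Comp_Hom[OF arr[OF f] arr[OF g]]])
        fix x assume x: "x \<in> X"
        have "app (g \<cdot>\<^bsub>Set_cat U\<^esub> f) x = app g (app f x)"
          using f x by (simp add: Comp_Set_cat Hom_Set_cat_iff compose_def)
        then show "on_arr ?F (g \<cdot>\<^bsub>Set_cat U\<^esub> f) \<cdot>\<^bsub>C\<^esub> inc K X x
            = (on_arr ?F g \<cdot>\<^bsub>C\<^esub> on_arr ?F f) \<cdot>\<^bsub>C\<^esub> inc K X x"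
          using C.Comp_assoc[OF coproduct_inclusion_Hom[OF coX x] arr[OF f] arr[OF g]]
            act[OF gf x] act[OF f x] act[OF g Hom_Set_cat_app[OF f x]] by simp
      qed
    qed
  qed
qed

section \<open>The given functor as a functor of copowers\<close>

theorem theorem4p17:
  fixes U :: "'u set set"
    and \<XX> :: "('o, 'm) cat"
    and z :: 'o
    and pw :: "'o \<Rightarrow> 'u set \<Rightarrow> 'o"
    and inc :: "'o \<Rightarrow> 'u set \<Rightarrow> 'u \<Rightarrow> 'm"
    and \<gamma> :: "('u set, 'u set_map, 'o, 'm) func"
  assumes "set_universe U"
    and "category \<XX>"
    and "has_coproducts U \<XX>"
    and "copower_choice U \<XX> z pw inc"
    and "covariant_functor (Set_cat U) \<XX> \<gamma>"
    and "sends_coproducts_to_coproducts U \<XX> \<gamma>"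
  shows "\<exists>K \<in> Obj \<XX>. naturally_equivalent (Set_cat U) \<XX> \<gamma> (copower_functor \<XX> z pw inc K)"
proof -
  interpret set_universe U by fact
  interpret \<gamma>: covariant_functor "Set_cat U" \<XX> \<gamma> by fact
  \<comment> \<open>Any element of the type would do: all its singletons belong to
    \<open>U\<close>.\<close>
  define u :: 'u where "u = undefined"
  define K where "K = on_obj \<gamma> {u}"
  have u: "{u} \<in> U" by (rule singleton)
  then have K: "K \<in> Obj \<XX>" unfolding K_def by (intro \<gamma>.on_obj_Obj) simp
  have "naturally_equivalent (Set_cat U) \<XX> \<gamma> (copower_functor \<XX> z pw inc K)"
  proof (rule naturally_equivalent_copowers)
    show "covariant_functor (Set_cat U) \<XX> \<gamma>" by fact
    show "covariant_functor (Set_cat U) \<XX> (copower_functor \<XX> z pw inc K)"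
      using assms(2,4) K by (rule covariant_functor_copower_functor)
    \<comment> \<open>Preservation of coproducts is applied to \<open>X\<close> as the coproduct of
      its points, with \<open>X\<close> itself as index set.\<close>
    show "is_coproduct \<XX> X (\<lambda>_. K) (on_obj \<gamma> X) (\<lambda>x. on_arr \<gamma> (point u X x))" if "X \<in> U" for X
      using assms(6) is_coproduct_points[OF u that] that
      unfolding sends_coproducts_to_coproducts_def K_def by blast
    show "is_coproduct \<XX> X (\<lambda>_. K) (on_obj (copower_functor \<XX> z pw inc K) X) (inc K X)"
      if "X \<in> U" for X
      using is_coproduct_copower_obj[OF assms(4) K that] by (simp add: copower_functor_on_obj)
    fix X Y l x assume l: "l \<in> Hom (Set_cat U) X Y" and x: "x \<in> X"
    then have "point u X x \<in> Hom (Set_cat U) {u} X"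
      by (intro point_Hom u) (simp_all add: Hom_Set_cat_iff)
    \<comment> \<open>Relabelling is the image under \<open>\<gamma>\<close> of the fact that
      \<open>l\<close> composed with the point \<open>x\<close> is the point
      \<open>app l x\<close>.\<close>
    from \<gamma>.on_arr_Comp[OF this l]
    show "on_arr \<gamma> l \<cdot>\<^bsub>\<XX>\<^esub> on_arr \<gamma> (point u X x) = on_arr \<gamma> (point u Y (app l x))"
      by (simp add: Comp_point[OF l])
    show "on_arr (copower_functor \<XX> z pw inc K) l \<cdot>\<^bsub>\<XX>\<^esub> inc K X x = inc K Y (app l x)"
      using assms(4) K l x by (rule copower_functor_on_arr_spec(2))
  qed
  with K show ?thesis by blast
qed

end
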